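(* Let $\mathbb{K}$ be $\mathbb{C}$ or $\mathbb{R}$ and let $\mathfrak{h}_2$ be the $5$-dimensional Heisenberg Lie algebra over $\mathbb{K}$ with basis $\{e_1,\dots,e_5\}$ and nonzero brackets $[e_1,e_3]=e_5$, $[e_2,e_4]=e_5$ (up to skew-symmetry). For $p,q\in\mathbb{K}$ let $\phi_4(p:q):\mathfrak{h}_2\times\mathfrak{h}_2\to\mathfrak{h}_2$ be the skew-symmetric bilinear map with $$\phi_4(e_1,e_4)=(p+q)e_1,\quad \phi_4(e_2,e_3)=-e_1,\quad \phi_4(e_2,e_4)=qe_2,\quad \phi_4(e_3,e_4)=e_2+pe_3,\quad \phi_4(e_4,e_5)=-(2p+q)e_5,$$ and all other values on pairs $(e_i,e_j)$ with $i<j$ equal to zero. Then for all $p,q\in\mathbb{K}$ the map $\phi_4(p:q)$ is a $2$-cocycle of $\mathfrak{h}_2$ with adjoint coefficients, and $\mu_t(d_4)(p:q)=[-,-]+t\,\phi_4(p:q)$, i.e. the bracket with nonzero values (up to skew-symmetry) $$[e_1,e_3]_t=e_5,\quad [e_1,e_4]_t=(p+q)te_1,\quad [e_2,e_3]_t=-te_1,\quad [e_2,e_4]_t=e_5+qte_2,$$ $$[e_3,e_4]_t=te_2+pte_3,\quad [e_4,e_5]_t=-(2p+q)te_5,$$ is an infinitesimal deformation of $\mathfrak{h}_2$ which is also a real deformation. Moreover, the linear span in $H^2(\mathfrak{h}_2,\mathfrak{h}_2)$ of the cohomology classes of the cocycles $\phi_4(p:q)$, $p,q\in\mathbb{K}$,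 is $3$-dimensional.
   Context: For a Lie algebra $(\mathfrak{g},[-,-])$ over $\mathbb{K}$, $C^q(\mathfrak{g},\mathfrak{g})=\mathrm{Hom}_{\mathbb{K}}(\Lambda^q\mathfrak{g},\mathfrak{g})$ is the Chevalley--Eilenberg cochain space with adjoint coefficients, with differential $d$, and $H^q(\mathfrak{g},\mathfrak{g})$ denotes its cohomology. A $2$-cochain $\phi$ is a $2$-cocycle iff the cyclic sum over $(x,y,z)$ of $[x,\phi(y,z)]+\phi(x,[y,z])$ vanishes for all $x,y,z\in\mathfrak{g}$; the $2$-coboundaries are the maps $(x,y)\mapsto f([x,y])-[f(x),y]-[x,f(y)]$ with $f:\mathfrak{g}\to\mathfrak{g}$ linear. Given a $2$-cochain $\phi$, extend the bracket $[-,-]_t=[-,-]+t\phi$ to $\mathfrak{g}[[t]]$ by $\mathbb{K}[[t]]$-bilinearity. It is called an infinitesimal deformation of $\mathfrak{g}$ if it satisfies the Jacobi identity modulo $t^2$ (equivalently, $\phi$ is a $2$-cocycle), and a real deformation if it satisfies the Jacobi identity in every order of $t$, i.e. if it is a Lie bracket on the $\mathbb{K}[[t]]$-module $\mathfrak{g}[[t]]$. (The word "real" here does not refer to the field $\mathbb{R}$.) *)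

theory Defs
  imports
    "HOL-Analysis.Cartesian_Space"
    "HOL-Computational_Algebra.Formal_Power_Series"
    "HOL-Library.Function_Algebras"
    "HOL-Library.Numeral_Type"
begin

section \<open>Lie algebras over commutative rings\<close>

text \<open>The scalars form a commutative ring, so that the same notion applies to a Lie algebra
  \<open>\<gg>\<close> over a field \<open>K\<close> and to the \<open>K[[t]]\<close>-module \<open>\<gg>[[t]]\<close>.\<close>

locale lie_algebra = module scale
  for scale :: "'r::comm_ring_1 \<Rightarrow> 'g::ab_group_add \<Rightarrow> 'g" +
  fixes bracket :: "'g \<Rightarrow> 'g \<Rightarrow> 'g"
  assumes bracket_hom_left: "module_hom scale scale (\<lambda>x. bracket x y)"
    and bracket_hom_right: "module_hom scale scale (\<lambda>y. bracket x y)"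
    and bracket_self: "bracket x x = 0"
    and jacobi: "bracket x (bracket y z) + bracket y (bracket z x) + bracket z (bracket x y) = 0"

section \<open>Extension to formal power series\<close>

text \<open>The elements of \<open>\<gg>[[t]]\<close> are the formal power series with coefficients in \<open>\<gg>\<close>.
  \<open>fps_conv \<beta>\<close> sends \<open>(\<Sum>i. f\<^sub>i t\<^sup>i, \<Sum>j. g\<^sub>j t\<^sup>j)\<close> to \<open>\<Sum>i j. \<beta>(f\<^sub>i, g\<^sub>j) t\<^bsup>i+j\<^esup>\<close>. For \<open>\<beta>\<close> the scalar
  multiplication of \<open>\<gg>\<close> this is the \<open>K[[t]]\<close>-module structure of \<open>\<gg>[[t]]\<close>; for a bilinear map
  \<open>\<beta>\<close> on \<open>\<gg>\<close> it is the \<open>K[[t]]\<close>-bilinear extension of \<open>\<beta>\<close> to \<open>\<gg>[[t]]\<close>.\<close>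

definition fps_conv ::
    "('a::zero \<Rightarrow> 'b::zero \<Rightarrow> 'c::comm_monoid_add) \<Rightarrow> 'a fps \<Rightarrow> 'b fps \<Rightarrow> 'c fps" where
  "fps_conv \<beta> f g = Abs_fps (\<lambda>n. \<Sum>i\<le>n. \<beta> (fps_nth f i) (fps_nth g (n - i)))"

section \<open>Cochains with adjoint coefficients in low degree, and deformations\<close>

context lie_algebra
begin

definition C1 :: "('g \<Rightarrow> 'g) set" where
  "C1 = {f. module_hom scale scale f}"

text \<open>Linear maps on the exterior square are encoded as alternating bilinear maps.\<close>

definition C2 :: "('g \<Rightarrow> 'g \<Rightarrow> 'g) set" where
  "C2 = {\<phi>. (\<forall>y. module_hom scale scale (\<lambda>x. \<phi> x y)) \<and>
             (\<forall>x. module_hom scale scale (\<lambda>y. \<phi> x y)) \<and> (\<forall>x. \<phi> x x = 0)}"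

text \<open>The Chevalley-Eilenberg differentials on 1- and 2-cochains, up to an overall sign that affects
  neither kernel nor image.\<close>

definition d1 :: "('g \<Rightarrow> 'g) \<Rightarrow> 'g \<Rightarrow> 'g \<Rightarrow> 'g" where
  "d1 f = (\<lambda>x y. f (bracket x y) - bracket (f x) y - bracket x (f y))"

definition d2 :: "('g \<Rightarrow> 'g \<Rightarrow> 'g) \<Rightarrow> 'g \<Rightarrow> 'g \<Rightarrow> 'g \<Rightarrow> 'g" where
  "d2 \<phi> = (\<lambda>x y z.
     (bracket x (\<phi> y z) + \<phi> x (bracket y z)) +
     (bracket y (\<phi> z x) + \<phi> y (bracket z x)) +
     (bracket z (\<phi> x y) + \<phi> z (bracket x y)))"

definition Z2 :: "('g \<Rightarrow> 'g \<Rightarrow> 'g) set" where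
  "Z2 = {\<phi> \<in> C2. \<forall>x y z. d2 \<phi> x y z = 0}"

definition B2 :: "('g \<Rightarrow> 'g \<Rightarrow> 'g) set" where
  "B2 = d1 ` C1"

text \<open>\<open>[x, y]\<^sub>t = [x, y] + t \<phi>(x, y)\<close> on \<open>\<gg>[[t]]\<close>, with \<open>fps_X\<close> in the role of \<open>t\<close>.\<close>

definition deformed_bracket :: "('g \<Rightarrow> 'g \<Rightarrow> 'g) \<Rightarrow> 'g fps \<Rightarrow> 'g fps \<Rightarrow> 'g fps" where
  "deformed_bracket \<phi> x y = fps_conv bracket x y + fps_conv scale fps_X (fps_conv \<phi> x y)"

text \<open>The Jacobi identity modulo \<open>t\<^sup>2\<close>: the coefficients of \<open>t\<^sup>0\<close> and \<open>t\<^sup>1\<close> of the Jacobiator vanish.\<close>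

definition infinitesimal_deformation :: "('g \<Rightarrow> 'g \<Rightarrow> 'g) \<Rightarrow> bool" where
  "infinitesimal_deformation \<phi> \<longleftrightarrow> \<phi> \<in> C2 \<and>
     (let br = deformed_bracket \<phi> in
      \<forall>x y z. \<forall>n<2. fps_nth (br x (br y z) + br y (br z x) + br z (br x y)) n = 0)"

definition real_deformation :: "('g \<Rightarrow> 'g \<Rightarrow> 'g) \<Rightarrow> bool" where
  "real_deformation \<phi> \<longleftrightarrow> \<phi> \<in> C2 \<and> lie_algebra (fps_conv scale) (deformed_bracket \<phi>)"

lemma module_hom_iff:
  "module_hom scale scale f \<longleftrightarrow> (\<forall>x y. f (x + y) = f x + f y) \<and> (\<forall>c x. f (scale c x) = scale c (f x))"
  by (simp add: module_hom_def module_hom_axioms_def module_axioms)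

lemma bracket_simps:
  "bracket (x + y) z = bracket x z + bracket y z"
  "bracket z (x + y) = bracket z x + bracket z y"
  "bracket (scale c x) z = scale c (bracket x z)"
  "bracket z (scale c x) = scale c (bracket z x)"
  "bracket (x - y) z = bracket x z - bracket y z"
  "bracket z (x - y) = bracket z x - bracket z y"
  "bracket 0 z = 0" "bracket z 0 = 0"
  by (fact module_hom.add[OF bracket_hom_left] module_hom.add[OF bracket_hom_right]
      module_hom.scale[OF bracket_hom_left] module_hom.scale[OF bracket_hom_right]
      module_hom.diff[OF bracket_hom_left] module_hom.diff[OF bracket_hom_right]
      module_hom.zero[OF bracket_hom_left] module_hom.zero[OF bracket_hom_right])+

lemma bracket_skew: "bracket x y = - bracket y x"
proof -
  have "bracket (x + y) (x + y) = 0" by (rule bracket_self)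
  then have "bracket x y + bracket y x = 0"
    unfolding bracket_simps by (simp add: bracket_self add.commute)
  then show ?thesis by (simp add: eq_neg_iff_add_eq_0)
qed

lemma jacobi': "bracket z (bracket x y) = - bracket x (bracket y z) - bracket y (bracket z x)"
proof -
  have "bracket z (bracket x y) = (bracket x (bracket y z) + bracket y (bracket z x)
      + bracket z (bracket x y)) - bracket x (bracket y z) - bracket y (bracket z x)"
    by (simp add: algebra_simps)
  then show ?thesis unfolding jacobi by simp
qed

lemma B2_subset_C2: "B2 \<subseteq> C2"
proof
  fix \<phi> assume "\<phi> \<in> B2"
  then obtain f where f: "module_hom scale scale f" and \<phi>: "\<phi> = d1 f"
    by (auto simp: B2_def C1_def)
  have a: "f (x + y) = f x + f y" "f (scale c x) = scale c (f x)" for x y c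
    using f by (auto simp: module_hom_iff)
  have z: "f 0 = 0" using f by (rule module_hom.zero)
  have s: "d1 f x x = 0" for x
    using bracket_skew[of "f x" x] by (simp add: d1_def bracket_self z)
  show "\<phi> \<in> C2"
    unfolding \<phi> C2_def module_hom_iff
    by (auto simp: s) (auto simp: d1_def a bracket_simps algebra_simps scale_right_diff_distrib)
qed

lemma B2_subset_Z2: "B2 \<subseteq> Z2"
proof
  fix \<phi> assume B: "\<phi> \<in> B2"
  then obtain f where f: "module_hom scale scale f" and \<phi>: "\<phi> = d1 f"
    by (auto simp: B2_def C1_def)
  have a: "f (x + y) = f x + f y" for x y
    using f by (auto simp: module_hom_iff)
  have "d2 (d1 f) x y z = 0" for x y z
  proof -
    have "d2 (d1 f) x y z =
        f (bracket x (bracket y z) + bracket y (bracket z x) + bracket z (bracket x y))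
        - (bracket (f x) (bracket y z) + bracket y (bracket z (f x)) + bracket z (bracket (f x) y))
        - (bracket x (bracket (f y) z) + bracket (f y) (bracket z x) + bracket z (bracket x (f y)))
        - (bracket x (bracket y (f z)) + bracket y (bracket (f z) x) + bracket (f z) (bracket x y))"
      unfolding d2_def d1_def bracket_simps a by (simp add: algebra_simps)
    also have "\<dots> = 0"
      using f by (simp only: jacobi) (simp add: module_hom.zero)
    finally show ?thesis .
  qed
  then show "\<phi> \<in> Z2"
    using B2_subset_C2 B by (auto simp: Z2_def \<phi>)
qed

lemma B2_zero: "0 \<in> B2"
proof -
  have "(\<lambda>_. 0) \<in> C1" by (simp add: C1_def module_hom_iff)
  moreover have "d1 (\<lambda>_. 0) = 0" by (simp add: d1_def bracket_simps fun_eq_iff)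
  ultimately show ?thesis unfolding B2_def by (metis imageI)
qed

lemma B2_add: assumes "\<phi> \<in> B2" "\<psi> \<in> B2" shows "\<phi> + \<psi> \<in> B2"
proof -
  obtain f g where *: "f \<in> C1" "g \<in> C1" "\<phi> = d1 f" "\<psi> = d1 g"
    using assms by (auto simp: B2_def)
  then have "(\<lambda>x. f x + g x) \<in> C1" by (simp add: C1_def module_hom_iff algebra_simps)
  moreover have "d1 (\<lambda>x. f x + g x) = \<phi> + \<psi>"
    by (simp add: * d1_def bracket_simps fun_eq_iff algebra_simps)
  ultimately show ?thesis unfolding B2_def by (metis imageI)
qed

lemma B2_scale: assumes "\<phi> \<in> B2" shows "(\<lambda>x y. scale c (\<phi> x y)) \<in> B2"
proof -
  obtain f where *: "f \<in> C1" "\<phi> = d1 f"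
    using assms by (auto simp: B2_def)
  then have "(\<lambda>x. scale c (f x)) \<in> C1" by (simp add: C1_def module_hom_iff algebra_simps)
  moreover have "d1 (\<lambda>x. scale c (f x)) = (\<lambda>x y. scale c (\<phi> x y))"
    by (simp add: * d1_def bracket_simps fun_eq_iff scale_right_diff_distrib)
  ultimately show ?thesis unfolding B2_def by (metis imageI)
qed

lemma B2_uminus: "\<phi> \<in> B2 \<Longrightarrow> - \<phi> \<in> B2"
  using B2_scale[of \<phi> "-1"] by (simp add: fun_Compl_def)

lemma Z2_zero: "0 \<in> Z2"
  using B2_zero B2_subset_Z2 by auto

lemma Z2_add: "\<phi> \<in> Z2 \<Longrightarrow> \<psi> \<in> Z2 \<Longrightarrow> \<phi> + \<psi> \<in> Z2"
proof -
  assume "\<phi> \<in> Z2" "\<psi> \<in> Z2"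
  moreover have "d2 (\<phi> + \<psi>) x y z = d2 \<phi> x y z + d2 \<psi> x y z" for x y z
    by (simp add: d2_def bracket_simps algebra_simps)
  ultimately show ?thesis by (simp add: Z2_def C2_def module_hom_iff algebra_simps)
qed

lemma Z2_scale: "\<phi> \<in> Z2 \<Longrightarrow> (\<lambda>x y. scale c (\<phi> x y)) \<in> Z2"
proof -
  assume "\<phi> \<in> Z2"
  moreover have "d2 (\<lambda>x y. scale c (\<phi> x y)) x y z = scale c (d2 \<phi> x y z)" for x y z
    by (simp add: d2_def bracket_simps algebra_simps)
  ultimately show ?thesis by (simp add: Z2_def C2_def module_hom_iff algebra_simps)
qed

lemma Z2_uminus: "\<phi> \<in> Z2 \<Longrightarrow> - \<phi> \<in> Z2"
  using Z2_scale[of \<phi> "-1"] by (simp add: fun_Compl_def)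

end

section \<open>The five-dimensional Heisenberg Lie algebra\<close>

text \<open>The underlying space is \<open>K\<^sup>5\<close>. The index type \<open>5\<close> consists of the residues modulo 5, hence
  of the five distinct elements \<open>1, 2, 3, 4, 5\<close> (where \<open>5 = 0\<close>). The definitions make sense over
  every field; \<open>K = \<real>\<close> or \<open>K = \<complex>\<close> is expressed by the class \<^class>\<open>real_normed_field\<close>, of which
  \<^typ>\<open>real\<close> and \<^typ>\<open>complex\<close> are instances and, by the Gelfand-Mazur theorem, the only ones up to
  isomorphism.\<close>

definition h2_e :: "5 \<Rightarrow> 'a::field ^ 5" where
  "h2_e i = axis i 1"

text \<open>The skew-symmetric bilinear map with the values \<open>T i j\<close> on the pairs \<open>(h2_e i, h2_e j)\<close>,
  for a table \<open>T\<close> that vanishes except on pairs \<open>(i, j)\<close> with \<open>i < j\<close>.\<close>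

definition skew_bilinear :: "(5 \<Rightarrow> 5 \<Rightarrow> 'a ^ 5) \<Rightarrow> 'a::field ^ 5 \<Rightarrow> 'a ^ 5 \<Rightarrow> 'a ^ 5" where
  "skew_bilinear T x y = (\<Sum>i\<in>UNIV. \<Sum>j\<in>UNIV. (x $ i * y $ j) *s (T i j - T j i))"

definition h2_bracket :: "'a::field ^ 5 \<Rightarrow> 'a ^ 5 \<Rightarrow> 'a ^ 5" where
  "h2_bracket = skew_bilinear (\<lambda>i j.
     if (i, j) = (1, 3) then h2_e 5
     else if (i, j) = (2, 4) then h2_e 5
     else 0)"

definition phi4 :: "'a::field \<Rightarrow> 'a \<Rightarrow> 'a ^ 5 \<Rightarrow> 'a ^ 5 \<Rightarrow> 'a ^ 5" where
  "phi4 p q = skew_bilinear (\<lambda>i j.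
     if (i, j) = (1, 4) then (p + q) *s h2_e 1
     else if (i, j) = (2, 3) then - h2_e 1
     else if (i, j) = (2, 4) then q *s h2_e 2
     else if (i, j) = (3, 4) then h2_e 2 + p *s h2_e 3
     else if (i, j) = (4, 5) then - ((2 * p + q) *s h2_e 5)
     else 0)"

lemma h2_e_nth: "h2_e i $ j = (if j = i then 1 else 0)"
  by (simp add: h2_e_def axis_def)

lemma UNIV_5: "(UNIV :: 5 set) = {1, 2, 3, 4, 5}"
proof -
  have "card {1, 2, 3, 4, 5 :: 5} = 5" by simp
  then show ?thesis by (intro card_subset_eq[symmetric]) auto
qed

lemma forall_5: "(\<forall>i::5. P i) \<longleftrightarrow> P 1 \<and> P 2 \<and> P 3 \<and> P 4 \<and> P 5"
proof -
  have "(\<forall>i::5. P i) \<longleftrightarrow> (\<forall>i\<in>UNIV. P i)" by simp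
  then show ?thesis unfolding UNIV_5 by simp
qed

lemma neq_5:
  "(1::5) \<noteq> 2" "(1::5) \<noteq> 3" "(1::5) \<noteq> 4" "(1::5) \<noteq> 5" "(2::5) \<noteq> 3"
  "(2::5) \<noteq> 4" "(2::5) \<noteq> 5" "(3::5) \<noteq> 4" "(3::5) \<noteq> 5" "(4::5) \<noteq> 5"
  by simp_all

lemma sum_5: "sum f (UNIV :: 5 set) = f 1 + f 2 + f 3 + f 4 + f 5"
  unfolding UNIV_5 by (simp add: add.assoc)

lemma h2_bracket_eq:
  "h2_bracket x y = (x $ 1 * y $ 3 - x $ 3 * y $ 1 + x $ 2 * y $ 4 - x $ 4 * y $ 2) *s h2_e 5"
  unfolding h2_bracket_def skew_bilinear_def sum_5
  by (simp only: prod.inject neq_5 neq_5[symmetric] if_True if_False simp_thms diff_zero diff_self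
      vec.scale_zero_right add_0_left add_0_right diff_0) (simp add: algebra_simps)

lemma skew_bilinear_e:
  fixes T :: "5 \<Rightarrow> 5 \<Rightarrow> 'a::field ^ 5"
  shows "skew_bilinear T (h2_e i) (h2_e j) = T i j - T j i"
proof -
  have "(h2_e i $ k * h2_e j $ l) *s v = (if k = i then if l = j then v else 0 else 0)" for k l and v :: "'a ^ 5"
    by (simp add: h2_e_nth)
  then have "skew_bilinear T (h2_e i) (h2_e j) =
      (\<Sum>k\<in>UNIV. \<Sum>l\<in>UNIV. if k = i then if l = j then T k l - T l k else 0 else 0)"
    by (simp only: skew_bilinear_def)
  also have "\<dots> = (\<Sum>k\<in>UNIV. if k = i then T k j - T j k else 0)"
    by (rule sum.cong) auto
  finally show ?thesis by simp
qed

interpretation h2: lie_algebra "(*s) :: 'a::field \<Rightarrow> 'a ^ 5 \<Rightarrow> 'a ^ 5" h2_bracket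
proof (unfold_locales)
qed (simp_all add: h2_bracket_eq h2_e_nth algebra_simps)

section \<open>The second adjoint cohomology space of the Heisenberg Lie algebra\<close>

text \<open>Only 2-cocycles represent elements of the quotient \<open>Z\<^sup>2 / B\<^sup>2\<close>: the relation is partial, and
  \<open>abs_h2_H2 \<phi>\<close> is meaningful only for \<open>\<phi> \<in> h2.Z2\<close>.\<close>

quotient_type (overloaded) 'a h2_H2 = "'a::field ^ 5 \<Rightarrow> 'a ^ 5 \<Rightarrow> 'a ^ 5" /
  partial: "\<lambda>\<phi> \<psi>. \<phi> \<in> h2.Z2 \<and> \<psi> \<in> h2.Z2 \<and> \<phi> - \<psi> \<in> h2.B2"
proof (rule part_equivpI)
  show "\<exists>\<phi>::'a ^ 5 \<Rightarrow> 'a ^ 5 \<Rightarrow> 'a ^ 5. \<phi> \<in> h2.Z2 \<and> \<phi> \<in> h2.Z2 \<and> \<phi> - \<phi> \<in> h2.B2"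
    using h2.Z2_zero h2.B2_zero by (intro exI[of _ 0]) simp
next
  show "symp (\<lambda>\<phi> \<psi>::'a ^ 5 \<Rightarrow> 'a ^ 5 \<Rightarrow> 'a ^ 5. \<phi> \<in> h2.Z2 \<and> \<psi> \<in> h2.Z2 \<and> \<phi> - \<psi> \<in> h2.B2)"
  proof (rule sympI)
    fix \<phi> \<psi> :: "'a ^ 5 \<Rightarrow> 'a ^ 5 \<Rightarrow> 'a ^ 5"
    assume "\<phi> \<in> h2.Z2 \<and> \<psi> \<in> h2.Z2 \<and> \<phi> - \<psi> \<in> h2.B2"
    then show "\<psi> \<in> h2.Z2 \<and> \<phi> \<in> h2.Z2 \<and> \<psi> - \<phi> \<in> h2.B2"
      using h2.B2_uminus[of "\<phi> - \<psi>"] by simp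
  qed
next
  show "transp (\<lambda>\<phi> \<psi>::'a ^ 5 \<Rightarrow> 'a ^ 5 \<Rightarrow> 'a ^ 5. \<phi> \<in> h2.Z2 \<and> \<psi> \<in> h2.Z2 \<and> \<phi> - \<psi> \<in> h2.B2)"
  proof (rule transpI)
    fix \<phi> \<psi> \<omega> :: "'a ^ 5 \<Rightarrow> 'a ^ 5 \<Rightarrow> 'a ^ 5"
    assume "\<phi> \<in> h2.Z2 \<and> \<psi> \<in> h2.Z2 \<and> \<phi> - \<psi> \<in> h2.B2" "\<psi> \<in> h2.Z2 \<and> \<omega> \<in> h2.Z2 \<and> \<psi> - \<omega> \<in> h2.B2"
    then show "\<phi> \<in> h2.Z2 \<and> \<omega> \<in> h2.Z2 \<and> \<phi> - \<omega> \<in> h2.B2"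
      using h2.B2_add[of "\<phi> - \<psi>" "\<psi> - \<omega>"] by simp
  qed
qed

instantiation h2_H2 :: (field) ab_group_add
begin

lift_definition zero_h2_H2 :: "'a h2_H2" is 0
  using h2.Z2_zero h2.B2_zero by simp

lift_definition plus_h2_H2 :: "'a h2_H2 \<Rightarrow> 'a h2_H2 \<Rightarrow> 'a h2_H2" is "(+)"
proof -
  fix \<phi> \<phi>' \<psi> \<psi>' :: "'a ^ 5 \<Rightarrow> 'a ^ 5 \<Rightarrow> 'a ^ 5"
  assume "\<phi> \<in> h2.Z2 \<and> \<phi>' \<in> h2.Z2 \<and> \<phi> - \<phi>' \<in> h2.B2" "\<psi> \<in> h2.Z2 \<and> \<psi>' \<in> h2.Z2 \<and> \<psi> - \<psi>' \<in> h2.B2"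
  then show "\<phi> + \<psi> \<in> h2.Z2 \<and> \<phi>' + \<psi>' \<in> h2.Z2 \<and> \<phi> + \<psi> - (\<phi>' + \<psi>') \<in> h2.B2"
    using h2.B2_add[of "\<phi> - \<phi>'" "\<psi> - \<psi>'"] by (simp add: h2.Z2_add algebra_simps)
qed

lift_definition uminus_h2_H2 :: "'a h2_H2 \<Rightarrow> 'a h2_H2" is uminus
proof -
  fix \<phi> \<psi> :: "'a ^ 5 \<Rightarrow> 'a ^ 5 \<Rightarrow> 'a ^ 5"
  assume "\<phi> \<in> h2.Z2 \<and> \<psi> \<in> h2.Z2 \<and> \<phi> - \<psi> \<in> h2.B2"
  then show "- \<phi> \<in> h2.Z2 \<and> - \<psi> \<in> h2.Z2 \<and> - \<phi> - - \<psi> \<in> h2.B2"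
    using h2.B2_uminus[of "\<phi> - \<psi>"] by (simp add: h2.Z2_uminus)
qed

definition minus_h2_H2 :: "'a h2_H2 \<Rightarrow> 'a h2_H2 \<Rightarrow> 'a h2_H2" where
  "minus_h2_H2 a b = a + - b"

instance
proof
  fix a b c :: "'a h2_H2"
  show "a + b + c = a + (b + c)"
    by transfer (simp add: h2.Z2_add h2.B2_zero algebra_simps)
  show "a + b = b + a"
    by transfer (simp add: h2.Z2_add h2.B2_zero algebra_simps)
  show "0 + a = a"
    by transfer (simp add: h2.Z2_zero h2.B2_zero)
  show "- a + a = 0"
    by transfer (simp add: h2.Z2_zero h2.B2_zero)
qed (simp add: minus_h2_H2_def)

end

lift_definition h2_H2_scale :: "'a::field \<Rightarrow> 'a h2_H2 \<Rightarrow> 'a h2_H2" is "\<lambda>c \<phi> x y. c *s \<phi> x y"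
proof -
  fix c :: 'a and \<phi> \<psi> :: "'a ^ 5 \<Rightarrow> 'a ^ 5 \<Rightarrow> 'a ^ 5"
  assume *: "\<phi> \<in> h2.Z2 \<and> \<psi> \<in> h2.Z2 \<and> \<phi> - \<psi> \<in> h2.B2"
  have "(\<lambda>x y. c *s \<phi> x y) - (\<lambda>x y. c *s \<psi> x y) = (\<lambda>x y. c *s (\<phi> - \<psi>) x y)"
    by (simp add: fun_eq_iff vec.scale_right_diff_distrib)
  with * have "(\<lambda>x y. c *s \<phi> x y) - (\<lambda>x y. c *s \<psi> x y) \<in> h2.B2"
    by (simp only: h2.B2_scale)
  then show "(\<lambda>x y. c *s \<phi> x y) \<in> h2.Z2 \<and> (\<lambda>x y. c *s \<psi> x y) \<in> h2.Z2 \<and>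
      (\<lambda>x y. c *s \<phi> x y) - (\<lambda>x y. c *s \<psi> x y) \<in> h2.B2"
    using * by (simp add: h2.Z2_scale)
qed

interpretation h2_H2: vector_space h2_H2_scale
proof
  fix a b :: 'a and x y :: "'a h2_H2"
  have eqI: "\<phi> - \<psi> \<in> h2.B2" if "\<And>x y. \<phi> x y = \<psi> x y" for \<phi> \<psi> :: "'a ^ 5 \<Rightarrow> 'a ^ 5 \<Rightarrow> 'a ^ 5"
  proof -
    have "\<phi> - \<psi> = 0" using that by (simp add: fun_eq_iff)
    then show ?thesis using h2.B2_zero by simp
  qed
  show "h2_H2_scale a (x + y) = h2_H2_scale a x + h2_H2_scale a y"
    by transfer (intro conjI h2.Z2_add h2.Z2_scale eqI; simp add: vec.scale_right_distrib)
  show "h2_H2_scale (a + b) x = h2_H2_scale a x + h2_H2_scale b x"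
    by transfer (intro conjI h2.Z2_add h2.Z2_scale eqI; simp add: vec.scale_left_distrib)
  show "h2_H2_scale a (h2_H2_scale b x) = h2_H2_scale (a * b) x"
    by transfer (auto intro!: h2.Z2_scale eqI)
  show "h2_H2_scale 1 x = x"
    by transfer (auto intro!: eqI)
qed

end

theory Submission
  imports Defs
begin

text \<open>A power series with coefficients in \<open>K\<^sup>5\<close> is the same as five power series over \<open>K\<close>. In these
  coordinates the deformed bracket is polynomial over the commutative ring \<open>K[[t]]\<close>, so that the Lie
  algebra axioms become ring identities. For the dimension, \<open>(p, q) \<mapsto> \<phi>\<^sub>4(p:q)\<close> is affine, so that the
  span is generated by three classes. A coboundary \<open>d f\<close> has values in \<open>K e\<^sub>5\<close> on the pairs of basis
  vectors with vanishing bracket, and \<open>d f(e\<^sub>1, e\<^sub>3) \<equiv> d f(e\<^sub>2, e\<^sub>4) \<equiv> f(e\<^sub>5)\<close> modulo \<open>e\<^sub>5\<close>; this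
  separates the three classes.\<close>

definition fps_coord :: "'n \<Rightarrow> ('a::zero ^ 'n::finite) fps \<Rightarrow> 'a fps" where
  "fps_coord i f = Abs_fps (\<lambda>n. fps_nth f n $ i)"

lemma fps_nth_coord [simp]: "fps_nth (fps_coord i f) n = fps_nth f n $ i"
  by (simp add: fps_coord_def)

lemma fps_vec_eq_iff: "f = g \<longleftrightarrow> (\<forall>i. fps_coord i f = fps_coord i g)"
  by (auto simp: fps_eq_iff vec_eq_iff)

lemma fps_coord_simps:
  "fps_coord i 0 = 0"
  "fps_coord i (f + g) = fps_coord i f + fps_coord i g"
  "fps_coord i (- h) = - fps_coord i h"
  "fps_coord i (fps_const v) = fps_const (v $ i)"
  for f g :: "('a::comm_monoid_add ^ 'n::finite) fps" and h :: "('b::ab_group_add ^ 'n) fps"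
    and v :: "'c::zero ^ 'n"
  by (auto simp: fps_eq_iff)

text \<open>For scalar multiplication, \<open>fps_conv\<close> is the Cauchy product in each
  coordinate, so \<open>K[[t]]\<close> acts by ordinary multiplication.\<close>

lemma fps_coord_conv_scale: "fps_coord i (fps_conv (*s) c f) = c * fps_coord i f"
  for c :: "'a::comm_ring_1 fps" and f :: "('a ^ 'n::finite) fps"
  by (simp add: fps_eq_iff fps_conv_def fps_mult_nth atLeast0AtMost)

lemma fps_coord_mult_nth:
  "fps_nth (fps_coord i f * fps_coord j g) n = (\<Sum>k\<le>n. fps_nth f k $ i * fps_nth g (n - k) $ j)"
  for f g :: "('a::comm_ring_1 ^ 'n::finite) fps"
  by (simp add: fps_mult_nth atLeast0AtMost)

lemma h2_bracket_nth:
  "h2_bracket x y $ 1 = 0"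
  "h2_bracket x y $ 2 = 0"
  "h2_bracket x y $ 3 = 0"
  "h2_bracket x y $ 4 = 0"
  "h2_bracket x y $ 5 = x $ 1 * y $ 3 - x $ 3 * y $ 1 + x $ 2 * y $ 4 - x $ 4 * y $ 2"
  by (simp_all add: h2_bracket_eq h2_e_nth)

lemma phi4_eq:
  "phi4 p q x y =
    (x $ 1 * y $ 4 - x $ 4 * y $ 1) *s ((p + q) *s h2_e 1)
    - (x $ 2 * y $ 3 - x $ 3 * y $ 2) *s h2_e 1
    + (x $ 2 * y $ 4 - x $ 4 * y $ 2) *s (q *s h2_e 2)
    + (x $ 3 * y $ 4 - x $ 4 * y $ 3) *s (h2_e 2 + p *s h2_e 3)
    - (x $ 4 * y $ 5 - x $ 5 * y $ 4) *s ((2 * p + q) *s h2_e 5)"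
  \<comment> \<open>The 25 table lookups are decided first, by distinctness of the indices; only
    then comes arithmetic.\<close>
  unfolding phi4_def skew_bilinear_def sum_5
  by (simp only: prod.inject neq_5 neq_5[symmetric] if_True if_False simp_thms diff_zero diff_self
      vec.scale_zero_right add_0_left add_0_right diff_0)
    (simp add: vec_eq_iff algebra_simps)

lemma phi4_nth:
  "phi4 p q x y $ 1 = (p + q) * (x $ 1 * y $ 4 - x $ 4 * y $ 1) - (x $ 2 * y $ 3 - x $ 3 * y $ 2)"
  "phi4 p q x y $ 2 = q * (x $ 2 * y $ 4 - x $ 4 * y $ 2) + (x $ 3 * y $ 4 - x $ 4 * y $ 3)"
  "phi4 p q x y $ 3 = p * (x $ 3 * y $ 4 - x $ 4 * y $ 3)"
  "phi4 p q x y $ 4 = 0"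
  "phi4 p q x y $ 5 = - ((2 * p + q) * (x $ 4 * y $ 5 - x $ 5 * y $ 4))"
  by (simp_all add: phi4_eq h2_e_nth mult.commute)

lemma fps_coord_h2_bracket:
  "fps_coord 1 (fps_conv h2_bracket x y) = 0"
  "fps_coord 2 (fps_conv h2_bracket x y) = 0"
  "fps_coord 3 (fps_conv h2_bracket x y) = 0"
  "fps_coord 4 (fps_conv h2_bracket x y) = 0"
  "fps_coord 5 (fps_conv h2_bracket x y) =
     fps_coord 1 x * fps_coord 3 y - fps_coord 3 x * fps_coord 1 y
     + fps_coord 2 x * fps_coord 4 y - fps_coord 4 x * fps_coord 2 y"
  by (simp_all add: fps_eq_iff fps_conv_def h2_bracket_nth fps_coord_mult_nth sum.distrib
      sum_subtractf)

lemma fps_coord_phi4: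
  "fps_coord 1 (fps_conv (phi4 p q) x y) =
     fps_const (p + q) * (fps_coord 1 x * fps_coord 4 y - fps_coord 4 x * fps_coord 1 y)
     - (fps_coord 2 x * fps_coord 3 y - fps_coord 3 x * fps_coord 2 y)"
  "fps_coord 2 (fps_conv (phi4 p q) x y) =
     fps_const q * (fps_coord 2 x * fps_coord 4 y - fps_coord 4 x * fps_coord 2 y)
     + (fps_coord 3 x * fps_coord 4 y - fps_coord 4 x * fps_coord 3 y)"
  "fps_coord 3 (fps_conv (phi4 p q) x y) =
     fps_const p * (fps_coord 3 x * fps_coord 4 y - fps_coord 4 x * fps_coord 3 y)"
  "fps_coord 4 (fps_conv (phi4 p q) x y) = 0"
  "fps_coord 5 (fps_conv (phi4 p q) x y) =
     - (fps_const (2 * p + q) * (fps_coord 4 x * fps_coord 5 y - fps_coord 5 x * fps_coord 4 y))"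
  by (simp_all only: fps_eq_iff fps_conv_def fps_coord_mult_nth sum.distrib
      sum_subtractf sum_negf fps_neg_nth fps_nth_coord fps_nth_Abs_fps fps_add_nth fps_sub_nth
      fps_mult_left_const_nth sum_component phi4_nth sum_distrib_left[symmetric] fps_zero_nth sum.neutral_const simp_thms)

lemma fps_coord_deformed_bracket:
  "fps_coord i (h2.deformed_bracket \<phi> x y) =
     fps_coord i (fps_conv h2_bracket x y) + fps_X * fps_coord i (fps_conv \<phi> x y)"
  by (simp add: h2.deformed_bracket_def fps_coord_simps fps_coord_conv_scale)

lemma phi4_C2: "phi4 p q \<in> h2.C2"
  by (simp add: h2.C2_def h2.module_hom_iff vec_eq_iff forall_5 phi4_nth algebra_simps)

lemma phi4_Z2: "phi4 p q \<in> h2.Z2"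
  using phi4_C2[of p q]
  by (simp add: h2.Z2_def h2.d2_def vec_eq_iff forall_5 phi4_nth h2_bracket_nth algebra_simps)

text \<open>Rewrites an equation in \<open>K^5[[t]]\<close> into five polynomial equations over the
  ring \<open>K[[t]]\<close>.\<close>

lemmas deformed_coords =
  fps_vec_eq_iff forall_5 fps_coord_deformed_bracket fps_coord_simps fps_coord_conv_scale
  fps_coord_h2_bracket fps_coord_phi4

lemma module_fps_vec:
  "module (fps_conv (*s) :: 'a::comm_ring_1 fps \<Rightarrow> ('a ^ 'n::finite) fps \<Rightarrow> ('a ^ 'n) fps)"
  by unfold_locales (simp_all add: fps_vec_eq_iff fps_coord_simps fps_coord_conv_scale algebra_simps)

text \<open>Behind the Jacobi identity: \<open>[-, e_4]_t\<close> is a derivation of the ideal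
  spanned by \<open>e_1, e_2, e_3, e_5\<close>. Its diagonal entries
  \<open>t(p+q), tq, tp, t(2p+q)\<close> add up along \<open>[e_1,e_3]_t = e_5\<close> and
  \<open>[e_2,e_3]_t = -t e_1\<close>. The proof itself just verifies ring identities.\<close>

lemma lie_algebra_phi4: "lie_algebra (fps_conv (*s)) (h2.deformed_bracket (phi4 p q))"
proof -
  interpret M: module "fps_conv (*s) :: 'a fps \<Rightarrow> ('a ^ 5) fps \<Rightarrow> ('a ^ 5) fps"
    by (rule module_fps_vec)
  \<comment> \<open>Unsplit, these constants would be atoms unrelated to \<open>fps_const p\<close>
    and \<open>fps_const q\<close>, and Jacobi would fail as a polynomial identity.\<close>
  have c: "fps_const (p + q) = fps_const p + fps_const q"
    "fps_const (2 * p + q) = 2 * fps_const p + fps_const q"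
    by (simp_all add: fps_eq_iff fps_numeral_fps_const)
  show ?thesis
  proof
    fix x y z :: "('a ^ 5) fps" and r :: "'a fps"
    let ?b = "h2.deformed_bracket (phi4 p q)"
    show "?b (x + y) z = ?b x z + ?b y z" "?b z (x + y) = ?b z x + ?b z y"
      by (simp_all add: deformed_coords algebra_simps)
    show "?b (fps_conv (*s) r x) y = fps_conv (*s) r (?b x y)"
      "?b x (fps_conv (*s) r y) = fps_conv (*s) r (?b x y)"
      by (simp_all add: deformed_coords algebra_simps)
    show "?b x x = 0"
      by (simp add: deformed_coords algebra_simps)
    show "?b x (?b y z) + ?b y (?b z x) + ?b z (?b x y) = 0"
      unfolding deformed_coords c by (intro conjI; algebra)
  qed
qed

lemma phi4_real_deformation: "h2.real_deformation (phi4 p q)"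
  by (simp add: h2.real_deformation_def phi4_C2 lie_algebra_phi4)

lemma (in lie_algebra) real_imp_infinitesimal_deformation:
  assumes "real_deformation \<phi>" shows "infinitesimal_deformation \<phi>"
proof -
  interpret D: lie_algebra "fps_conv scale" "deformed_bracket \<phi>"
    using assms by (simp add: real_deformation_def)
  \<comment> \<open>Deleting \<open>fps_add_nth\<close> keeps the cyclic sum whole under
    \<open>fps_nth\<close>, so that \<open>D.jacobi\<close> can rewrite it to 0.\<close>
  show ?thesis
    using assms by (simp add: infinitesimal_deformation_def real_deformation_def D.jacobi Let_def
        del: fps_add_nth)
qed

lemma abs_h2_H2_eq_0_iff: "\<phi> \<in> h2.Z2 \<Longrightarrow> abs_h2_H2 \<phi> = 0 \<longleftrightarrow> \<phi> \<in> h2.B2"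
  using Quotient_rel[OF Quotient_h2_H2, of \<phi> 0]
  by (simp add: zero_h2_H2_def h2.Z2_zero h2.B2_zero)

lemma abs_h2_H2_add:
  "\<phi> \<in> h2.Z2 \<Longrightarrow> \<psi> \<in> h2.Z2 \<Longrightarrow> abs_h2_H2 (\<phi> + \<psi>) = abs_h2_H2 \<phi> + abs_h2_H2 \<psi>"
  by (simp add: plus_h2_H2.abs_eq h2.B2_zero)

lemma abs_h2_H2_scale:
  "\<phi> \<in> h2.Z2 \<Longrightarrow> abs_h2_H2 (\<lambda>x y. c *s \<phi> x y) = h2_H2_scale c (abs_h2_H2 \<phi>)"
  by (simp add: h2_H2_scale.abs_eq h2.B2_zero)

lemma abs_h2_H2_combination:
  fixes a b c :: "'a::field"
  assumes "\<phi> \<in> h2.Z2" "\<psi> \<in> h2.Z2" "\<omega> \<in> h2.Z2"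
  defines "\<theta> \<equiv> (\<lambda>x y. a *s \<phi> x y) + ((\<lambda>x y. b *s \<psi> x y) + (\<lambda>x y. c *s \<omega> x y))"
  shows "\<theta> \<in> h2.Z2"
    and "abs_h2_H2 \<theta> = h2_H2_scale a (abs_h2_H2 \<phi>)
      + (h2_H2_scale b (abs_h2_H2 \<psi>) + h2_H2_scale c (abs_h2_H2 \<omega>))"
  using assms by (simp_all add: abs_h2_H2_add abs_h2_H2_scale h2.Z2_add h2.Z2_scale)

lemma (in vector_space) independent_3:
  assumes "\<And>r s t. scale r a + (scale s b + scale t c) = 0 \<Longrightarrow> r = 0 \<and> s = 0 \<and> t = 0"
  shows "independent {a, b, c}" and "card {a, b, c} = 3"
proof -
  \<comment> \<open>Two equal vectors would satisfy the relation with coefficients 1 and -1.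
    Distinctness lets a sum over the set be read as a sum of three terms.\<close>
  have "a \<noteq> b" using assms[of 1 "-1" 0] by auto
  moreover have "a \<noteq> c" using assms[of 1 0 "-1"] by auto
  moreover have "b \<noteq> c" using assms[of 0 1 "-1"] by auto
  ultimately show "card {a, b, c} = 3" and "independent {a, b, c}"
    using assms by (auto simp: dependent_finite)
qed

text \<open>Three linear functionals on cochains that vanish on coboundaries and hence descend to
  \<open>H^2\<close>.\<close>

lemma B2_nth:
  assumes "\<phi> \<in> h2.B2"
  shows "\<phi> (h2_e 2) (h2_e 3) $ 1 = 0" "\<phi> (h2_e 3) (h2_e 4) $ 3 = 0"
    "\<phi> (h2_e 2) (h2_e 4) $ 2 = \<phi> (h2_e 1) (h2_e 3) $ 2"
proof -
  obtain f where f: "module_hom (*s) (*s) f" and \<phi>: "\<phi> = h2.d1 f"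
    using assms by (auto simp: h2.B2_def h2.C1_def)
  have [simp]: "f 0 = 0" using f by (rule module_hom.zero)
  show "\<phi> (h2_e 2) (h2_e 3) $ 1 = 0" "\<phi> (h2_e 3) (h2_e 4) $ 3 = 0"
    "\<phi> (h2_e 2) (h2_e 4) $ 2 = \<phi> (h2_e 1) (h2_e 3) $ 2"
    by (simp_all add: \<phi> h2.d1_def h2_bracket_eq h2_e_nth)
qed

lemma phi4_classes_independent:
  assumes "h2_H2_scale r (abs_h2_H2 (phi4 0 0)) + (h2_H2_scale s (abs_h2_H2 (phi4 1 0))
    + h2_H2_scale t (abs_h2_H2 (phi4 0 1))) = 0"
  shows "r = 0 \<and> s = 0 \<and> t = 0"
proof -
  let ?\<theta> = "(\<lambda>x y. r *s phi4 0 0 x y) + ((\<lambda>x y. s *s phi4 1 0 x y) + (\<lambda>x y. t *s phi4 0 1 x y))"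
  note \<theta> = abs_h2_H2_combination[OF phi4_Z2 phi4_Z2 phi4_Z2]
  have "?\<theta> \<in> h2.B2"
    using assms by (simp only: abs_h2_H2_eq_0_iff[OF \<theta>(1), symmetric] \<theta>(2))
  \<comment> \<open>On \<open>?\<theta>\<close> the three functionals take the values
    \<open>-(r + s + t)\<close>, \<open>s\<close> and \<open>t\<close>.\<close>
  from B2_nth[OF this] show ?thesis
    by (simp add: phi4_nth h2_e_nth algebra_simps)
qed

text \<open>\<open>phi4\<close> is affine but not linear in \<open>(p, q)\<close>, because of its
  constant entries \<open>-e_1\<close> and \<open>e_2\<close>. Hence barycentric coordinates with
  respect to \<open>(0,0), (1,0), (0,1)\<close>, and a span of dimension 3 rather than 2.\<close>

lemma phi4_class:
  "abs_h2_H2 (phi4 p q) = h2_H2_scale (1 - p - q) (abs_h2_H2 (phi4 0 0))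
    + (h2_H2_scale p (abs_h2_H2 (phi4 1 0)) + h2_H2_scale q (abs_h2_H2 (phi4 0 1)))"
proof -
  have "phi4 p q = (\<lambda>x y. (1 - p - q) *s phi4 0 0 x y)
      + ((\<lambda>x y. p *s phi4 1 0 x y) + (\<lambda>x y. q *s phi4 0 1 x y))"
    by (simp add: fun_eq_iff vec_eq_iff forall_5 phi4_nth algebra_simps)
  then show ?thesis
    by (simp only: abs_h2_H2_combination(2)[OF phi4_Z2 phi4_Z2 phi4_Z2])
qed

lemma dim_span_phi4_classes:
  "h2_H2.dim (h2_H2.span (range (\<lambda>(p, q). abs_h2_H2 (phi4 p q)) :: 'a::field h2_H2 set)) = 3"
proof -
  let ?S = "range (\<lambda>(p, q). abs_h2_H2 (phi4 p q)) :: 'a h2_H2 set"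
  let ?B = "{abs_h2_H2 (phi4 0 0), abs_h2_H2 (phi4 1 0), abs_h2_H2 (phi4 0 1)} :: 'a h2_H2 set"
  have "abs_h2_H2 (phi4 p q) \<in> h2_H2.span ?B" for p q
    unfolding phi4_class[of p q]
    by (intro h2_H2.span_add h2_H2.span_scale h2_H2.span_base) auto
  then have "?S \<subseteq> h2_H2.span ?B" by auto
  moreover have "?B \<subseteq> ?S" by force
  \<comment> \<open>\<open>?B\<close> is a basis chosen inside the spanning family \<open>?S\<close>
    itself.\<close>
  ultimately have "h2_H2.dim ?S = card ?B"
    using h2_H2.basis_card_eq_dim h2_H2.independent_3(1)[OF phi4_classes_independent] by metis
  then show ?thesis
    using h2_H2.independent_3(2)[OF phi4_classes_independent] by (simp only: h2_H2.dim_span)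
qed

theorem theorem4p2:
  shows
    "(\<forall>p q :: 'k::real_normed_field.
        phi4 p q \<in> h2.Z2 \<and>
        h2.infinitesimal_deformation (phi4 p q) \<and>
        h2.real_deformation (phi4 p q) \<and>
        (let E = (\<lambda>i. fps_const (h2_e i));
             tE = (\<lambda>c i. fps_conv (*s) (fps_const c * fps_X) (E i));
             br = (\<lambda>i j. h2.deformed_bracket (phi4 p q) (E i) (E j))
         in br 1 3 = E 5 \<and>
            br 1 4 = tE (p + q) 1 \<and>
            br 2 3 = - tE 1 1 \<and>
            br 2 4 = E 5 + tE q 2 \<and>
            br 3 4 = tE 1 2 + tE p 3 \<and>
            br 4 5 = - tE (2 * p + q) 5 \<and>
            br 1 2 = 0 \<and> br 1 5 = 0 \<and> br 2 5 = 0 \<and> br 3 5 = 0)) \<and>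
     h2_H2.dim (h2_H2.span
       (range (\<lambda>(p, q). abs_h2_H2 (phi4 p q)) :: 'k h2_H2 set)) = 3"
proof (intro conjI allI dim_span_phi4_classes)
  fix p q :: 'k
  show "phi4 p q \<in> h2.Z2" by (rule phi4_Z2)
  show "h2.real_deformation (phi4 p q)" by (rule phi4_real_deformation)
  then show "h2.infinitesimal_deformation (phi4 p q)"
    by (rule h2.real_imp_infinitesimal_deformation)
qed (simp add: Let_def deformed_coords h2_e_nth mult.commute)

end
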